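(* Let $\{\varphi_n\}_{n=0}^\infty$ be a linearly dense stationary sequence of unit vectors in a Hilbert space $H$ with singular spectral measure $\mu$, with associated coefficient sequence $\{\alpha_n\}_{n\ge0}$. Let $\vec{x}\in H$, and suppose the noise $\{\epsilon_n\}_{n=0}^\infty\subset\mathbb{C}$ is such that $\varepsilon(z)=\sum_{n=0}^\infty\epsilon_nz^n$ has an $L^2(\mu)$-boundary $\varepsilon^\star\in L^2(\mu)$. Then: (1) $$\lim_{r\to1^-}\Big\|\sum_{n=0}^\infty r^n\Big(\sum_{j=0}^n\alpha_{n-j}\epsilon_j\Big)\varphi_n\Big\|_H=0;$$ (2) consequently, $$\lim_{r\to1^-}\sum_{n=0}^\infty r^n\Big(\sum_{j=0}^n\alpha_{n-j}\big(\langle\vec{x},\varphi_j\rangle+\epsilon_j\big)\Big)\varphi_n=\vec{x}$$ in the norm of $H$.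
   Context: $H$ is a complex Hilbert space with inner product linear in the first variable. A sequence $\{\varphi_n\}_{n=0}^\infty$ of unit vectors is stationary if $\langle\varphi_{n+k},\varphi_{m+k}\rangle=\langle\varphi_n,\varphi_m\rangle$ for all $n,m,k\in\mathbb{N}_0$. Its spectral measure is the Borel probability measure $\mu$ on $[0,1)$ with $\langle\varphi_n,\varphi_m\rangle=\int_0^1 e^{2\pi i(n-m)x}\,d\mu(x)$; it is singular if it is singular with respect to Lebesgue measure. Linearly dense means the linear span is dense in $H$. Let $\mu^+(z)=\int_0^1\frac{1}{1-ze^{-2\pi i x}}\,d\mu(x)$ for $z$ in the open unit disc $\mathbb{D}$, and $b(z)=1-\frac{1}{\mu^+(z)}$; for $\mu$ singular, $b$ is an inner function with $b(0)=0$. The sequence $\{\alpha_n\}$ is defined by $1-b(z)=\sum_{n=0}^\infty\alpha_n z^n$. It is assumed that the power series $\varepsilon(z)$ has radius of convergence at least $1$. A holomorphic function $f$ on $\mathbb{D}$ has an $L^2(\mu)$-boundary $f^\star\in L^2(\mu)$ if $f(re^{2\pi i x})\to f^\star(x)$ in the $L^2(\mu)$-norm as $r\to1^-$. *)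

theory Defs
  imports "HOL-Analysis.Analysis" "HOL-Probability.Probability_Measure"
begin

(* Complex inner product spaces, linear in the first argument. Positivity and definiteness of
   cinner follow from cinner_eq_norm and the norm axioms of real_normed_vector. *)
class complex_inner = real_normed_vector +
  fixes scaleC :: "complex \<Rightarrow> 'a \<Rightarrow> 'a" (infixr "*\<^sub>C" 75)
    and cinner :: "'a \<Rightarrow> 'a \<Rightarrow> complex"
  assumes scaleC_add_right: "a *\<^sub>C (x + y) = a *\<^sub>C x + a *\<^sub>C y"
    and scaleC_add_left: "(a + b) *\<^sub>C x = a *\<^sub>C x + b *\<^sub>C x"
    and scaleC_scaleC: "a *\<^sub>C b *\<^sub>C x = (a * b) *\<^sub>C x"
    and scaleC_of_real: "complex_of_real r *\<^sub>C x = r *\<^sub>R x"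
    and cinner_commute: "cinner x y = cnj (cinner y x)"
    and cinner_add_left: "cinner (x + y) z = cinner x z + cinner y z"
    and cinner_scaleC_left: "cinner (a *\<^sub>C x) y = a * cinner x y"
    and cinner_eq_norm: "cinner x x = complex_of_real ((norm x)\<^sup>2)"

class complex_hilbert_space = complex_inner + complete_space

instantiation complex :: complex_hilbert_space
begin

definition scaleC_complex :: "complex \<Rightarrow> complex \<Rightarrow> complex"
  where "scaleC_complex a x = a * x"

definition cinner_complex :: "complex \<Rightarrow> complex \<Rightarrow> complex"
  where "cinner_complex x y = x * cnj y"

instance
proof
  fix x :: complex
  show "cinner x x = complex_of_real ((norm x)\<^sup>2)"
    unfolding cinner_complex_def by (rule complex_norm_square [symmetric])
qed (simp_all add: scaleC_complex_def cinner_complex_def ring_distribs scaleR_conv_of_real mult.assoc)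

end

lemma vector_space_scaleC: "vector_space (scaleC :: complex \<Rightarrow> 'a::complex_inner \<Rightarrow> 'a)"
proof
  show "1 *\<^sub>C x = x" for x :: 'a
    using scaleC_of_real[of 1 x] by simp
qed (simp_all add: scaleC_add_right scaleC_add_left scaleC_scaleC)

definition linearly_dense :: "(nat \<Rightarrow> 'a::complex_inner) \<Rightarrow> bool"
  where "linearly_dense \<phi> \<longleftrightarrow> closure (module.span scaleC (range \<phi>)) = UNIV"

definition stationary :: "(nat \<Rightarrow> 'a::complex_inner) \<Rightarrow> bool"
  where "stationary \<phi> \<longleftrightarrow>
    (\<forall>n. norm (\<phi> n) = 1) \<and>
    (\<forall>n m k. cinner (\<phi> (n + k)) (\<phi> (m + k)) = cinner (\<phi> n) (\<phi> m))"

(* The underlying space of \<mu> is the half-open interval, so integrals over \<mu> are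
   integrals over [0,1). The measure is unique, as its Fourier coefficients are prescribed. *)
definition is_spectral_measure :: "(nat \<Rightarrow> 'a::complex_inner) \<Rightarrow> real measure \<Rightarrow> bool"
  where "is_spectral_measure \<phi> \<mu> \<longleftrightarrow>
    prob_space \<mu> \<and>
    sets \<mu> = sets (restrict_space borel {0..<1}) \<and>
    (\<forall>n m. cinner (\<phi> n) (\<phi> m) =
      (LINT x|\<mu>. exp (2 * of_real pi * \<i> * (of_nat n - of_nat m) * of_real x)))"

definition lebesgue_singular :: "real measure \<Rightarrow> bool"
  where "lebesgue_singular \<mu> \<longleftrightarrow>
    (\<exists>N\<in>sets \<mu>. emeasure lborel N = 0 \<and> emeasure \<mu> (space \<mu> - N) = 0)"

definition mu_plus :: "real measure \<Rightarrow> complex \<Rightarrow> complex"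
  where "mu_plus \<mu> z = (LINT x|\<mu>. 1 / (1 - z * exp (- (2 * of_real pi * \<i> * of_real x))))"

definition b_fun :: "real measure \<Rightarrow> complex \<Rightarrow> complex"
  where "b_fun \<mu> z = 1 - 1 / mu_plus \<mu> z"

definition is_coeff_seq :: "real measure \<Rightarrow> (nat \<Rightarrow> complex) \<Rightarrow> bool"
  where "is_coeff_seq \<mu> \<alpha> \<longleftrightarrow>
    (\<forall>z\<in>ball 0 1. (\<lambda>n. \<alpha> n * z ^ n) sums (1 - b_fun \<mu> z))"

definition L2_fun :: "'b measure \<Rightarrow> ('b \<Rightarrow> complex) \<Rightarrow> bool"
  where "L2_fun M f \<longleftrightarrow> f \<in> borel_measurable M \<and> integrable M (\<lambda>x. (cmod (f x))\<^sup>2)"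

definition L2_norm :: "'b measure \<Rightarrow> ('b \<Rightarrow> complex) \<Rightarrow> real"
  where "L2_norm M f = sqrt (LINT x|M. (cmod (f x))\<^sup>2)"

(* For 0 < r < 1 and \<mu> finite on [0,1), x \<mapsto> f (r exp (2 pi i x)) is bounded and measurable
   because f is holomorphic, so the difference below lies in L2 and its L2_norm is genuine. *)
definition has_L2_boundary ::
    "(complex \<Rightarrow> complex) \<Rightarrow> real measure \<Rightarrow> (real \<Rightarrow> complex) \<Rightarrow> bool"
  where "has_L2_boundary f \<mu> f_star \<longleftrightarrow>
    f holomorphic_on ball 0 1 \<and> L2_fun \<mu> f_star \<and>
    ((\<lambda>r. L2_norm \<mu> (\<lambda>x. f (of_real r * exp (2 * of_real pi * \<i> * of_real x)) - f_star x))
      \<longlongrightarrow> 0) (at_left 1)"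

definition power_series :: "(nat \<Rightarrow> complex) \<Rightarrow> complex \<Rightarrow> complex"
  where "power_series a z = (\<Sum>n. a n * z ^ n)"

end

(* The map sum a_n phi_n |-> sum a_n e^(2 pi i n t) is isometric into L^2(mu), so the Abel mean of
   the noise has norm ||(1 - b)(r .) eps(r .)|| in L^2(mu), where |1 - b| = 1/|mu^+| <= 2. If
   |1 - b| > d at r e^(2 pi i t), then the interval of radius 1 - r around t has mu-measure at most
   81 (1 - r) / d, because Re mu^+ is a Poisson-type average. Covering a Lebesgue null set that
   carries mu by an open set of small length, and that by a grid of mesh 1 - r, shows that the set
   of such t has small mu-measure; hence (1 - b)(r .) -> 0 boundedly in L^2(mu), which gives (1).

   For (2) with zero noise, (1 - b) mu^+ = 1 says that alpha * <x, phi_j> are the coefficients of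
   the Kaczmarz iteration, whose partial sums are bounded by 2 ||x||; so the Abel means are
   uniformly bounded operators. On x = phi_k the generating function is z^k plus (1 - b) times a
   polynomial, and the latter vanishes in the limit as in (1). Density concludes. *)
theory Submission
  imports Defs
begin

section \<open>Complex inner product spaces\<close>

interpretation scaleC: vector_space "scaleC :: complex \<Rightarrow> 'a::complex_inner \<Rightarrow> 'a"
  by (rule vector_space_scaleC)

text \<open>Completeness turns absolute summability into summability, which
  \<open>sums_synth\<close> relies on.\<close>

instance complex_hilbert_space \<subseteq> banach ..

lemma cinner_add_right: "cinner x (y + z) = cinner x y + cinner x z"
  for x :: "'a::complex_inner"
  by (metis cinner_commute cinner_add_left complex_cnj_add)

lemma cinner_scaleC_right: "cinner x (a *\<^sub>C y) = cnj a * cinner x y"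
  for x :: "'a::complex_inner"
  by (metis cinner_commute cinner_scaleC_left complex_cnj_mult)

lemma cinner_zero_left [simp]: "cinner 0 y = 0"
  for y :: "'a::complex_inner"
  using cinner_add_left[of 0 0 y] by simp

lemma cinner_zero_right [simp]: "cinner y 0 = 0"
  for y :: "'a::complex_inner"
  using cinner_add_right[of y 0 0] by simp

lemma cinner_diff_left: "cinner (x - y) z = cinner x z - cinner y z"
  for x :: "'a::complex_inner"
  using cinner_add_left[of "x - y" y z] by simp

lemma cinner_diff_right: "cinner x (y - z) = cinner x y - cinner x z"
  for x :: "'a::complex_inner"
  using cinner_add_right[of x "y - z" z] by simp

lemma cinner_sum_left: "cinner (\<Sum>i\<in>I. f i) y = (\<Sum>i\<in>I. cinner (f i) y)"
  for y :: "'a::complex_inner"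
  by (induction I rule: infinite_finite_induct) (auto simp: cinner_add_left)

lemma cinner_sum_right: "cinner y (\<Sum>i\<in>I. f i) = (\<Sum>i\<in>I. cinner y (f i))"
  for y :: "'a::complex_inner"
  by (induction I rule: infinite_finite_induct) (auto simp: cinner_add_right)

lemma norm_scaleC: "norm (a *\<^sub>C x) = cmod a * norm x"
  for x :: "'a::complex_inner"
proof -
  have "complex_of_real ((norm (a *\<^sub>C x))\<^sup>2) = a * cnj a * cinner x x"
    by (simp only: cinner_eq_norm[symmetric] cinner_scaleC_left cinner_scaleC_right mult_ac)
  also have "\<dots> = complex_of_real ((cmod a * norm x)\<^sup>2)"
    by (simp only: cinner_eq_norm complex_norm_square[symmetric] of_real_mult[symmetric] power_mult_distrib)
  finally have "(norm (a *\<^sub>C x))\<^sup>2 = (cmod a * norm x)\<^sup>2"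
    by (simp only: of_real_eq_iff)
  then show ?thesis
    by (simp add: power2_eq_iff_nonneg)
qed

text \<open>Pythagoras for the projection onto the line of \<open>u\<close>. Nonnegativity of the
  left side is Cauchy-Schwarz, and dropping the subtracted square shows that a Kaczmarz step does
  not increase the error.\<close>

lemma norm_diff_projection:
  fixes x u :: "'a::complex_inner"
  assumes "norm u = 1"
  shows "(norm (x - cinner x u *\<^sub>C u))\<^sup>2 = (norm x)\<^sup>2 - (cmod (cinner x u))\<^sup>2"
proof -
  have u: "cinner u u = 1"
    using assms by (simp add: cinner_eq_norm)
  have "complex_of_real ((norm (x - cinner x u *\<^sub>C u))\<^sup>2)
      = cinner x x - cinner x u * cnj (cinner x u)"
    by (simp add: cinner_eq_norm[symmetric] cinner_diff_left cinner_diff_right cinner_scaleC_left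
        cinner_scaleC_right u cinner_commute[of u x] del: of_real_power)
  also have "\<dots> = complex_of_real ((norm x)\<^sup>2 - (cmod (cinner x u))\<^sup>2)"
    by (simp only: cinner_eq_norm complex_norm_square[symmetric] of_real_diff)
  finally show ?thesis
    by (simp only: of_real_eq_iff)
qed

lemma norm_diff_projection_le:
  fixes x u :: "'a::complex_inner"
  assumes "norm u = 1"
  shows "norm (x - cinner x u *\<^sub>C u) \<le> norm x"
  by (rule power2_le_imp_le) (simp_all add: norm_diff_projection[OF assms])

lemma cmod_cinner_le:
  fixes x u :: "'a::complex_inner"
  assumes "norm u = 1"
  shows "cmod (cinner x u) \<le> norm x"
proof (rule power2_le_imp_le)
  have "0 \<le> (norm x)\<^sup>2 - (cmod (cinner x u))\<^sup>2"
    using norm_diff_projection[OF assms, of x, symmetric] by simp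
  then show "(cmod (cinner x u))\<^sup>2 \<le> (norm x)\<^sup>2"
    by simp
qed auto

section \<open>Stationary sequences as exponentials in \<open>L\<^sup>2(\<mu>)\<close>\<close>

lemma fps_conv_radius_bounded:
  fixes f :: "complex fps"
  assumes "\<And>n. cmod (fps_nth f n) \<le> B"
  shows "fps_conv_radius f \<ge> 1"
  unfolding fps_conv_radius_def
proof (rule conv_radius_geI_ex')
  fix r :: real
  assume r: "0 < r" "ereal r < 1"
  show "summable (\<lambda>n. fps_nth f n * of_real r ^ n)"
  proof (rule summable_comparison_test')
    show "summable (\<lambda>n. B * r ^ n)"
      using r by (intro summable_mult summable_geometric) auto
    show "norm (fps_nth f n * of_real r ^ n) \<le> B * r ^ n" for n
      using assms[of n] r by (auto simp: norm_mult norm_power intro!: mult_right_mono)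
  qed
qed

lemma fps_conv_radius_mult_ge_1:
  fixes f g :: "complex fps"
  assumes "fps_conv_radius f \<ge> 1" "fps_conv_radius g \<ge> 1"
  shows "fps_conv_radius (f * g) \<ge> 1"
  using fps_conv_radius_mult[of f g] assms by (meson min.boundedI order_trans)

lemma less_conv_radius:
  fixes f :: "complex fps"
  assumes "fps_conv_radius f \<ge> 1" "cmod z < 1"
  shows "ereal (cmod z) < fps_conv_radius f"
  using assms by (metis ereal_less(3) less_le_trans)

section \<open>Boundary exponentials and the isometry into \<open>L\<^sup>2(\<mu>)\<close>\<close>

definition circ :: "real \<Rightarrow> complex"
  where "circ t = exp (2 * of_real pi * \<i> * of_real t)"

lemma circ_eq_cis: "circ t = cis (2 * pi * t)"
  by (simp add: circ_def cis_conv_exp mult_ac)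

lemma norm_circ [simp]: "cmod (circ t) = 1"
  by (simp add: circ_eq_cis)

lemma circ_power: "circ t ^ n = cis (2 * pi * t * real n)"
  unfolding circ_eq_cis Complex.DeMoivre by (rule arg_cong[where f = cis]) simp

text \<open>The exponent is spelled as in \<open>mu_plus_def\<close>, whose kernel thereby becomes 1
  / (1 - z cnj (circ t)).\<close>

lemma cnj_circ: "exp (- (2 * of_real pi * \<i> * of_real t)) = cnj (circ t)"
  by (simp add: circ_def exp_cnj)

lemma continuous_on_circ: "continuous_on S circ"
  unfolding circ_def by (intro continuous_intros)

text \<open>The Abel mean of a vector series. Taking the coefficients from a formal power series
  turns the convolution with \<alpha> into a multiplication.\<close>

definition synth :: "(nat \<Rightarrow> 'a::complex_hilbert_space) \<Rightarrow> real \<Rightarrow> complex fps \<Rightarrow> 'a"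
  where "synth \<phi> r f = (\<Sum>n. of_real (r ^ n) *\<^sub>C fps_nth f n *\<^sub>C \<phi> n)"

locale spectral_sequence = prob_space \<mu>
  for \<mu> :: "real measure" +
  fixes \<phi> :: "nat \<Rightarrow> 'a::complex_hilbert_space"
  assumes stat: "stationary \<phi>"
    and spec: "is_spectral_measure \<phi> \<mu>"
begin

lemma norm_phi: "norm (\<phi> n) = 1"
  using stat by (simp add: stationary_def)

lemma cinner_phi_shift: "cinner (\<phi> (n + k)) (\<phi> (m + k)) = cinner (\<phi> n) (\<phi> m)"
  using stat by (simp add: stationary_def)

lemma sets_mu: "sets \<mu> = sets (restrict_space borel {0..<1})"
  using spec by (simp add: is_spectral_measure_def)

lemma space_mu: "space \<mu> = {0..<1}"
  using sets_eq_imp_space_eq[OF sets_mu] by (simp add: space_restrict_space)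

lemma cinner_phi: "cinner (\<phi> n) (\<phi> m) = (LINT t|\<mu>. circ t ^ n * cnj (circ t ^ m))"
proof -
  have "exp (2 * of_real pi * \<i> * (of_nat n - of_nat m) * of_real t) = circ t ^ n * cnj (circ t ^ m)"
    for t
    by (simp add: circ_power cis_cnj cis_mult) (simp add: cis_conv_exp algebra_simps)
  then show ?thesis
    using spec by (simp add: is_spectral_measure_def)
qed

lemma borel_measurable_mu:
  "f \<in> borel_measurable borel \<Longrightarrow> f \<in> borel_measurable \<mu>"
  by (metis measurable_cong_sets measurable_restrict_space1 sets_mu)

lemma borel_measurable_mu_continuous:
  "continuous_on UNIV f \<Longrightarrow> f \<in> borel_measurable \<mu>"
  by (intro borel_measurable_mu borel_measurable_continuous_onI)

lemma continuous_on_eval_circ: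
  assumes "fps_conv_radius f \<ge> 1" "0 \<le> r" "r < 1"
  shows "continuous_on UNIV (\<lambda>t. eval_fps f (of_real r * circ t))"
proof (rule continuous_on_eval_fps')
  show "continuous_on UNIV (\<lambda>t. complex_of_real r * circ t)"
    by (intro continuous_intros continuous_on_circ)
  show "range (\<lambda>t. complex_of_real r * circ t) \<subseteq> eball 0 (fps_conv_radius f)"
    using assms less_conv_radius[of f "of_real r"] by (auto simp: in_eball_iff norm_mult)
qed

lemma summable_synth:
  assumes "fps_conv_radius f \<ge> 1" "0 \<le> r" "r < 1"
  shows "summable (\<lambda>n. norm (of_real (r ^ n) *\<^sub>C fps_nth f n *\<^sub>C \<phi> n))"
proof -
  have "summable (\<lambda>n. norm (fps_nth f n * of_real r ^ n))"
    using assms less_conv_radius[of f "of_real r"]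
    by (intro abs_summable_in_conv_radius) (auto simp: fps_conv_radius_def)
  then show ?thesis
    using assms by (simp add: norm_scaleC norm_phi norm_mult norm_power mult.commute)
qed

lemma sums_synth:
  assumes "fps_conv_radius f \<ge> 1" "0 \<le> r" "r < 1"
  shows "(\<lambda>n. of_real (r ^ n) *\<^sub>C fps_nth f n *\<^sub>C \<phi> n) sums synth \<phi> r f"
  unfolding synth_def by (rule summable_sums [OF summable_norm_cancel [OF summable_synth [OF assms]]])

text \<open>Expanding both squares gives the same double sum, since \<open>cinner_phi\<close>
  identifies each inner product with an integral. The equation is kept in the complex numbers, where
  the single terms live.\<close>

lemma norm_sum_phi:
  "complex_of_real ((norm (\<Sum>n<N. a n *\<^sub>C \<phi> n))\<^sup>2) =
    (LINT t|\<mu>. of_real ((cmod (\<Sum>n<N. a n * circ t ^ n))\<^sup>2))"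
proof -
  have int: "integrable \<mu> (\<lambda>t. c * (circ t ^ n * cnj (circ t ^ m)))" for c n m
    by (rule integrable_const_bound[where B = "cmod c"])
      (auto simp: norm_mult norm_power intro!: borel_measurable_mu_continuous continuous_intros
        continuous_on_circ)
  have "complex_of_real ((norm (\<Sum>n<N. a n *\<^sub>C \<phi> n))\<^sup>2) =
    (\<Sum>n<N. \<Sum>m<N. a n * cnj (a m) * cinner (\<phi> n) (\<phi> m))"
    by (simp only: cinner_eq_norm[symmetric] cinner_sum_left cinner_sum_right cinner_scaleC_left
        cinner_scaleC_right sum_distrib_left) (subst sum.swap, simp add: mult_ac)
  also have "\<dots> = (\<Sum>n<N. \<Sum>m<N. LINT t|\<mu>. a n * cnj (a m) * (circ t ^ n * cnj (circ t ^ m)))"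
    by (simp only: cinner_phi integral_mult_right_zero)
  also have "\<dots> = (LINT t|\<mu>. (\<Sum>n<N. \<Sum>m<N. a n * cnj (a m) * (circ t ^ n * cnj (circ t ^ m))))"
    by (simp only: Bochner_Integration.integral_sum Bochner_Integration.integrable_sum int)
  also have "\<dots> = (LINT t|\<mu>. of_real ((cmod (\<Sum>n<N. a n * circ t ^ n))\<^sup>2))"
    by (intro Bochner_Integration.integral_cong refl, simp only: complex_norm_square cnj_sum sum_product)
      (simp add: mult_ac)
  finally show ?thesis .
qed

text \<open>The finite isometry passes to the limit: the squared norms of the partial sums converge
  to both sides. The dominating constant comes from absolute convergence at radius r < 1, and
  constants are integrable for a probability measure.\<close>

lemma norm_synth:
  assumes f: "fps_conv_radius f \<ge> 1" and r: "0 \<le> r" "r < 1"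
  shows "(norm (synth \<phi> r f))\<^sup>2 = (LINT t|\<mu>. (cmod (eval_fps f (of_real r * circ t)))\<^sup>2)"
proof (rule LIMSEQ_unique)
  define a where "a n = of_real (r ^ n) * fps_nth f n" for n
  define s where "s N t = (\<Sum>n<N. a n * circ t ^ n)" for N t
  have suma: "summable (\<lambda>n. cmod (a n))"
    using summable_synth[OF assms] by (simp add: a_def norm_scaleC norm_phi norm_mult)
  have lim: "(\<lambda>N. s N t) \<longlonglongrightarrow> eval_fps f (of_real r * circ t)" for t
    using sums_eval_fps[OF less_conv_radius[OF f, of "of_real r * circ t"]] r
    by (simp add: sums_def s_def a_def norm_mult power_mult_distrib mult_ac)
  have bound: "cmod (s N t) \<le> (\<Sum>n. cmod (a n))" for N t
  proof -
    have "cmod (s N t) \<le> (\<Sum>n<N. cmod (a n))"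
      unfolding s_def by (rule sum_norm_le) (simp add: norm_mult norm_power)
    also have "\<dots> \<le> (\<Sum>n. cmod (a n))"
      by (rule sum_le_suminf[OF suma]) auto
    finally show ?thesis .
  qed
  have eq: "(norm (\<Sum>n<N. of_real (r ^ n) *\<^sub>C fps_nth f n *\<^sub>C \<phi> n))\<^sup>2 = (LINT t|\<mu>. (cmod (s N t))\<^sup>2)" for N
  proof -
    have "complex_of_real ((norm (\<Sum>n<N. a n *\<^sub>C \<phi> n))\<^sup>2) = of_real (LINT t|\<mu>. (cmod (s N t))\<^sup>2)"
      unfolding norm_sum_phi s_def by (rule integral_complex_of_real)
    then have "(norm (\<Sum>n<N. a n *\<^sub>C \<phi> n))\<^sup>2 = (LINT t|\<mu>. (cmod (s N t))\<^sup>2)"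
      by (simp only: of_real_eq_iff)
    then show ?thesis
      by (simp only: a_def scaleC_scaleC)
  qed
  show "(\<lambda>N. LINT t|\<mu>. (cmod (s N t))\<^sup>2) \<longlonglongrightarrow> (norm (synth \<phi> r f))\<^sup>2"
    using sums_synth[OF assms] unfolding eq[symmetric] sums_def by (intro tendsto_intros)
  show "(\<lambda>N. LINT t|\<mu>. (cmod (s N t))\<^sup>2)
      \<longlonglongrightarrow> (LINT t|\<mu>. (cmod (eval_fps f (of_real r * circ t)))\<^sup>2)"
  proof (rule integral_dominated_convergence[where w = "\<lambda>_. (\<Sum>n. cmod (a n))\<^sup>2"])
    show "(\<lambda>t. (cmod (eval_fps f (of_real r * circ t)))\<^sup>2) \<in> borel_measurable \<mu>"
      by (intro borel_measurable_mu_continuous continuous_on_power continuous_on_norm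
          continuous_on_eval_circ[OF assms])
    show "(\<lambda>t. (cmod (s N t))\<^sup>2) \<in> borel_measurable \<mu>" for N
      unfolding s_def by (intro borel_measurable_mu_continuous continuous_intros continuous_on_circ)
    show "AE t in \<mu>. (\<lambda>N. (cmod (s N t))\<^sup>2) \<longlonglongrightarrow> (cmod (eval_fps f (of_real r * circ t)))\<^sup>2"
      using lim by (intro AE_I2 tendsto_intros)
    show "AE t in \<mu>. norm ((cmod (s N t))\<^sup>2) \<le> (\<Sum>n. cmod (a n))\<^sup>2" for N
      using bound by (intro AE_I2) (auto intro!: power_mono)
  qed simp
qed

section \<open>The transform mu^+ as generating function of the autocorrelations\<close>

definition C where "C = Abs_fps (\<lambda>n. cinner (\<phi> 0) (\<phi> n))"

lemma fps_conv_radius_cinner: "fps_conv_radius (Abs_fps (\<lambda>n. cinner x (\<phi> n))) \<ge> 1"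
  by (rule fps_conv_radius_bounded[where B = "norm x"]) (simp add: cmod_cinner_le norm_phi)

lemma fps_conv_radius_C: "fps_conv_radius C \<ge> 1"
  unfolding C_def by (rule fps_conv_radius_cinner)

text \<open>The kernel is a geometric series in z cnj (circ t), integrated term by term; the n-th
  moment is the autocorrelation \<open>cinner (\<phi> 0) (\<phi> n)\<close>.\<close>

lemma mu_plus_eq_eval_fps:
  assumes z: "cmod z < 1"
  shows "mu_plus \<mu> z = eval_fps C z"
proof -
  have int: "integrable \<mu> (\<lambda>t. (z * cnj (circ t)) ^ n)" for n
    by (rule integrable_const_bound[where B = "cmod z ^ n"])
      (auto simp: norm_mult norm_power power_mult_distrib
        intro!: borel_measurable_mu_continuous continuous_intros continuous_on_circ)
  have geo: "(\<lambda>n. (z * cnj (circ t)) ^ n) sums (1 / (1 - z * cnj (circ t)))" for t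
    using z by (intro geometric_sums) (simp add: norm_mult)
  have "(\<lambda>n. LINT t|\<mu>. (z * cnj (circ t)) ^ n) sums (LINT t|\<mu>. (\<Sum>n. (z * cnj (circ t)) ^ n))"
  proof (rule sums_integral)
    show "AE t in \<mu>. summable (\<lambda>n. norm ((z * cnj (circ t)) ^ n))"
      using z by (simp add: norm_power norm_mult summable_geometric)
    show "summable (\<lambda>n. LINT t|\<mu>. norm ((z * cnj (circ t)) ^ n))"
      using z by (simp add: norm_power norm_mult summable_geometric prob_space)
  qed (rule int)
  moreover have "(LINT t|\<mu>. (z * cnj (circ t)) ^ n) = fps_nth C n * z ^ n" for n
    by (simp add: C_def cinner_phi power_mult_distrib mult.commute[of "z ^ n"])
  moreover have "(LINT t|\<mu>. (\<Sum>n. (z * cnj (circ t)) ^ n)) = mu_plus \<mu> z"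
    by (simp add: mu_plus_def cnj_circ sums_unique[OF geo, symmetric])
  ultimately show ?thesis
    by (simp add: eval_fps_def sums_iff)
qed

end

section \<open>Boundary behaviour of \<open>1 / \<mu>\<^sup>+\<close> for singular \<open>\<mu>\<close>\<close>

lemma Re_inverse_one_minus: "Re (1 / (1 - w)) = (1 - Re w) / (cmod (1 - w))\<^sup>2"
  by (simp add: Re_divide cmod_power2)

text \<open>Expanding |1 - w|^2 = 1 - 2 Re w + |w|^2 and using |w| < 1 bounds the denominator in
  \<open>Re_inverse_one_minus\<close> by twice the numerator.\<close>

lemma Re_inverse_one_minus_ge_half:
  assumes "cmod w < 1"
  shows "1 / 2 \<le> Re (1 / (1 - w))"
proof -
  have "w \<noteq> 1"
    using assms by auto
  have "(cmod w)\<^sup>2 \<le> 1"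
    using assms by (simp add: power_le_one)
  moreover have "(cmod (1 - w))\<^sup>2 = 1 - 2 * Re w + (cmod w)\<^sup>2"
    unfolding cmod_power2 by (simp add: power2_eq_square algebra_simps)
  ultimately have "(cmod (1 - w))\<^sup>2 \<le> 2 * (1 - Re w)"
    by simp
  then show ?thesis
    using \<open>w \<noteq> 1\<close> by (simp add: Re_inverse_one_minus field_simps)
qed

text \<open>The distance |1 - w| is at most 1 - r in the radial direction plus a chord of length at
  most 2 pi |t - s| <= 8 (1 - r), by pi < 4. Its square is at most 81 (1 - r)^2, against a numerator
  of at least 1 - r.\<close>

lemma Re_inverse_one_minus_ge_near:
  assumes r: "0 \<le> r" "r < 1" and st: "\<bar>t - s\<bar> \<le> 1 - r"
  shows "1 / (81 * (1 - r)) \<le> Re (1 / (1 - of_real r * circ t * cnj (circ s)))"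
proof -
  define u where "u = circ t * cnj (circ s)"
  define w where "w = of_real r * u"
  have u: "u = exp (\<i> * of_real (2 * pi * (t - s)))"
    by (simp add: u_def circ_eq_cis cis_cnj cis_mult) (simp add: cis_conv_exp algebra_simps)
  have "cmod (u - 1) = 2 * \<bar>sin (pi * (t - s))\<bar>"
    using dist_exp_i_1[of "2 * pi * (t - s)"] unfolding u by (simp add: dist_norm)
  also have "\<dots> \<le> 2 * \<bar>pi * (t - s)\<bar>"
    using abs_sin_x_le_abs_x by simp
  also have "\<dots> = 2 * pi * \<bar>t - s\<bar>"
    by (simp add: abs_mult)
  also have "\<dots> \<le> 8 * (1 - r)"
    using st pi_less_4 by (intro mult_mono) auto
  finally have 1: "cmod (u - 1) \<le> 8 * (1 - r)" .
  have nu: "cmod u = 1"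
    by (simp add: u_def norm_mult)
  have "1 - w = (1 - of_real r) * u - (u - 1)"
    by (simp add: w_def algebra_simps)
  also have "cmod \<dots> \<le> cmod ((1 - of_real r) * u) + cmod (u - 1)"
    by (rule norm_triangle_ineq4)
  also have "cmod ((1 - of_real r) * u) = 1 - r"
  proof -
    have "1 - of_real r = complex_of_real (1 - r)"
      by simp
    then show ?thesis
      using r nu by (simp only: norm_mult norm_of_real) simp
  qed
  finally have le: "cmod (1 - w) \<le> 9 * (1 - r)"
    using 1 by simp
  have nw: "cmod w = r"
    using r nu by (simp add: w_def norm_mult)
  have Re: "1 - r \<le> 1 - Re w"
    using complex_Re_le_cmod[of w] nw by simp
  have "w \<noteq> 1"
    using nw r by auto
  have "1 / (81 * (1 - r)) = (1 - r) / (9 * (1 - r))\<^sup>2"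
    using r unfolding power2_eq_square by (simp add: divide_simps) (simp add: algebra_simps)
  also have "\<dots> \<le> (1 - Re w) / (cmod (1 - w))\<^sup>2"
    using le Re r \<open>w \<noteq> 1\<close> by (intro frac_le power_mono) auto
  finally show ?thesis
    by (simp add: Re_inverse_one_minus w_def u_def mult.assoc)
qed

text \<open>Outer regularity of Lebesgue measure; as \<open>N\<close> is null, \<open>T\<close> has
  the measure of T - N.\<close>

lemma emeasure_lborel_outer_open:
  fixes N :: "real set"
  assumes N: "N \<in> sets borel" "emeasure lborel N = 0" and e: "e > 0"
  obtains T where "open T" "N \<subseteq> T" "emeasure lborel T < ennreal e"
proof -
  obtain T where T: "open T" "N \<subseteq> T" "emeasure lebesgue (T - N) < ennreal e"
  proof (rule sets_lebesgue_outer_open[of N e])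
    show "N \<in> sets lebesgue"
      using N by simp
  qed (use e in blast)+
  have "emeasure lborel T \<le> emeasure lborel ((T - N) \<union> N)"
    using T N by (intro emeasure_mono) auto
  also have "\<dots> \<le> emeasure lborel (T - N) + emeasure lborel N"
    using T N by (intro emeasure_subadditive) auto
  also have "\<dots> = emeasure lebesgue (T - N)"
    using T N by simp
  finally show thesis
    using T that by (meson le_less_trans)
qed

section \<open>Grid covering and averages over \<mu>\<close>

context spectral_sequence
begin

lemma sets_mu_Int: "B \<in> sets borel \<Longrightarrow> B \<inter> {0..<1} \<in> sets \<mu>"
  by (auto simp: sets_mu sets_restrict_space)

lemma sets_mu_imp_borel: "B \<in> sets \<mu> \<Longrightarrow> B \<in> sets borel"
  by (auto simp: sets_mu sets_restrict_space)

lemma integrable_mu_bounded: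
  fixes f :: "real \<Rightarrow> 'b::{banach, second_countable_topology}"
  assumes "f \<in> borel_measurable \<mu>" "\<And>t. norm (f t) \<le> B"
  shows "integrable \<mu> f"
  using assms by (intro integrable_const_bound[where B = B]) auto

text \<open>The cells meeting \<open>F\<close> are disjoint, lie in \<open>T\<close> and have \<open>\<mu>\<close>-measure at most \<open>c\<close> times their
  length, so no covering theorem is needed.\<close>

lemma measure_le_grid:
  assumes h: "0 < h" and c: "0 \<le> c"
    and T: "T \<in> sets borel" "emeasure lborel T < \<infinity>"
    and F: "F \<subseteq> {0..<1}"
    and sub: "\<And>t. t \<in> F \<Longrightarrow> {t - h..t + h} \<subseteq> T"
    and le: "\<And>t. t \<in> F \<Longrightarrow> measure \<mu> ({t - h..t + h} \<inter> {0..<1}) \<le> c * h"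
  shows "measure \<mu> F \<le> c * measure lborel T"
proof -
  define cell where "cell k = {real k * h..<(real k + 1) * h}" for k
  define n where "n = nat \<lceil>1 / h\<rceil>"
  define K where "K = {k. k < n \<and> cell k \<inter> F \<noteq> {}}"
  have fin: "finite K"
    by (simp add: K_def)
  \<comment> \<open>Half-open cells are the fibres of floor (t / h), which makes them
    disjoint.\<close>
  have cell_iff: "t \<in> cell k \<longleftrightarrow> \<lfloor>t / h\<rfloor> = int k" for t k
    using h by (simp add: cell_def floor_eq_iff field_simps)
  \<comment> \<open>The last cell may reach beyond 1: its \<mu>-mass is cut to [0,1), while its full
    length is still counted inside \<open>T\<close>.\<close>
  have meas: "cell k \<inter> {0..<1} \<in> sets \<mu>" for k
    unfolding cell_def by (intro sets_mu_Int) auto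
  \<comment> \<open>A cell has length \<open>h\<close>, so it stays within distance \<open>h\<close>
    of each of its points.\<close>
  have near: "\<exists>t\<in>F. cell k \<subseteq> {t - h..t + h}" if k: "k \<in> K" for k
  proof -
    obtain t where "t \<in> F" "t \<in> cell k"
      using k unfolding K_def by blast
    then show ?thesis
      by (intro bexI[of _ t]) (auto simp: cell_def algebra_simps)
  qed
  have "F \<subseteq> (\<Union>k\<in>K. cell k \<inter> {0..<1})"
  proof
    fix t assume t: "t \<in> F"
    then have t01: "0 \<le> t" "t < 1"
      using F by auto
    define k where "k = nat \<lfloor>t / h\<rfloor>"
    have k: "t \<in> cell k"
      using t01 h by (simp add: cell_iff k_def)
    have "real k * h < 1"
      using k t01 by (simp add: cell_def)
    then have "real k < 1 / h"
      using h by (simp add: field_simps)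
    then have "k < n"
      unfolding n_def by linarith
    then show "t \<in> (\<Union>k\<in>K. cell k \<inter> {0..<1})"
      using k t t01 by (auto simp: K_def)
  qed
  then have "measure \<mu> F \<le> measure \<mu> (\<Union>k\<in>K. cell k \<inter> {0..<1})"
    using fin by (intro finite_measure_mono sets.finite_UN meas)
  also have "\<dots> \<le> (\<Sum>k\<in>K. measure \<mu> (cell k \<inter> {0..<1}))"
    using fin by (intro finite_measure_subadditive_finite) (auto intro: meas)
  also have "\<dots> \<le> (\<Sum>k\<in>K. c * measure lborel (cell k))"
  proof (rule sum_mono)
    fix k assume "k \<in> K"
    then obtain t where t: "t \<in> F" "cell k \<subseteq> {t - h..t + h}"
      using near by blast
    have "measure \<mu> (cell k \<inter> {0..<1}) \<le> measure \<mu> ({t - h..t + h} \<inter> {0..<1})"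
      using t by (intro finite_measure_mono sets_mu_Int) auto
    also have "\<dots> \<le> c * h"
      by (rule le[OF t(1)])
    also have "h = measure lborel (cell k)"
      using h by (simp add: cell_def algebra_simps)
    finally show "measure \<mu> (cell k \<inter> {0..<1}) \<le> c * measure lborel (cell k)" .
  qed
  also have "\<dots> = c * (\<Sum>k\<in>K. measure lborel (cell k))"
    by (simp add: sum_distrib_left)
  also have "(\<Sum>k\<in>K. measure lborel (cell k)) = measure lborel (\<Union>k\<in>K. cell k)"
    using fin h
    by (intro measure_finite_Union[symmetric])
      (auto simp: disjoint_family_on_def cell_iff, auto simp: cell_def)
  also have "\<dots> \<le> measure lborel T"
  proof (rule measure_mono_fmeasurable)
    show "(\<Union>k\<in>K. cell k) \<subseteq> T"
      using near sub by blast
    show "(\<Union>k\<in>K. cell k) \<in> sets lborel"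
      using fin by (intro sets.finite_UN) (auto simp: cell_def)
    show "T \<in> fmeasurable lborel"
      using T by (intro fmeasurableI) auto
  qed
  finally show ?thesis
    using c by (simp add: mult_left_mono)
qed

text \<open>Pointwise bounds for the kernel are averaged over \<mu>. The first bound uses total mass
  1; the second keeps only the points within 1 - r of \<open>t\<close>, since the real part is
  positive elsewhere. Distance is taken on the line, not on the circle, which can only lose
  mass.\<close>

lemma
  assumes r: "0 \<le> r" "r < 1"
  shows Re_mu_plus_ge_half: "1 / 2 \<le> Re (mu_plus \<mu> (of_real r * circ t))"
    and Re_mu_plus_ge_near: "measure \<mu> ({t - (1 - r)..t + (1 - r)} \<inter> {0..<1}) / (81 * (1 - r))
      \<le> Re (mu_plus \<mu> (of_real r * circ t))"
proof -
  define f where "f s = 1 / (1 - of_real r * circ t * cnj (circ s))" for s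
  have nw: "cmod (of_real r * circ t * cnj (circ s)) = r" for s
    using r by (simp add: norm_mult)
  then have ne: "1 - of_real r * circ t * cnj (circ s) \<noteq> 0" for s
    using r by (metis eq_iff_diff_eq_0 norm_one less_irrefl)
  have "cmod (f s) \<le> 1 / (1 - r)" for s
  proof -
    have "1 - r \<le> cmod (1 - of_real r * circ t * cnj (circ s))"
      using norm_triangle_ineq2[of 1 "of_real r * circ t * cnj (circ s)"] nw by simp
    then show ?thesis
      using r by (simp add: f_def norm_divide frac_le)
  qed
  then have int: "integrable \<mu> f"
    using ne unfolding f_def
    by (intro integrable_mu_bounded borel_measurable_mu_continuous continuous_intros continuous_on_circ)
      auto
  have Re: "Re (mu_plus \<mu> (of_real r * circ t)) = (LINT s|\<mu>. Re (f s))"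
  proof -
    have "mu_plus \<mu> (of_real r * circ t) = (LINT s|\<mu>. f s)"
      by (simp add: mu_plus_def cnj_circ f_def)
    then show ?thesis
      by (simp add: integral_Re[OF int])
  qed
  have half: "1 / 2 \<le> Re (f s)" for s
    using Re_inverse_one_minus_ge_half nw r by (simp add: f_def)
  have "(LINT s|\<mu>. 1 / 2) \<le> (LINT s|\<mu>. Re (f s))"
    using int half by (intro integral_mono) auto
  then show "1 / 2 \<le> Re (mu_plus \<mu> (of_real r * circ t))"
    by (simp add: Re prob_space)
  define J where "J = {t - (1 - r)..t + (1 - r)} \<inter> {0..<1}"
  have J: "J \<in> sets \<mu>"
    unfolding J_def by (intro sets_mu_Int) auto
  have "(LINT s|\<mu>. indicator J s * (1 / (81 * (1 - r)))) \<le> (LINT s|\<mu>. Re (f s))"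
  proof (intro integral_mono)
    show "indicator J s * (1 / (81 * (1 - r))) \<le> Re (f s)" for s
      using Re_inverse_one_minus_ge_near[OF r, of t s] half[of s] unfolding f_def
      by (cases "s \<in> J") (auto simp: J_def)
  qed (use int J in \<open>auto simp: less_top[symmetric]\<close>)
  then show "measure \<mu> ({t - (1 - r)..t + (1 - r)} \<inter> {0..<1}) / (81 * (1 - r))
      \<le> Re (mu_plus \<mu> (of_real r * circ t))"
    using J by (simp add: Re J_def[symmetric])
qed

end

lemma circ_surj:
  assumes "cmod z < 1"
  obtains r t where "0 \<le> r" "r < 1" "z = of_real r * circ t"
proof
  show "z = of_real (cmod z) * circ (Arg z / (2 * pi))"
    by (simp add: circ_eq_cis rcis_cmod_Arg flip: rcis_def)
qed (use assms in auto)

section \<open>The function 1 - b and its decay in mean square\<close>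

locale singular_spectral_sequence = spectral_sequence +
  fixes \<alpha> :: "nat \<Rightarrow> complex"
  assumes sing: "lebesgue_singular \<mu>"
    and coeff: "is_coeff_seq \<mu> \<alpha>"
begin

definition A where "A = Abs_fps \<alpha>"

lemma eval_A: "cmod z < 1 \<Longrightarrow> eval_fps A z = 1 / mu_plus \<mu> z"
  using coeff by (auto simp: is_coeff_seq_def A_def eval_fps_def sums_iff b_fun_def)

lemma fps_conv_radius_A: "fps_conv_radius A \<ge> 1"
  unfolding fps_conv_radius_def
proof (rule conv_radius_geI_ex')
  fix r :: real
  assume "0 < r" "ereal r < 1"
  then show "summable (\<lambda>n. fps_nth A n * of_real r ^ n)"
    using coeff by (auto simp: is_coeff_seq_def A_def sums_iff)
qed

text \<open>Equality of the functions near 0 gives equality of the power series; mu^+ has no zero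
  because its real part is at least 1/2. Read on coefficients, this is the recursion behind the
  Kaczmarz iteration.\<close>

lemma A_times_C: "A * C = 1"
proof (rule eval_fps_eqD)
  show "0 < fps_conv_radius (A * C)"
    using fps_conv_radius_mult_ge_1[OF fps_conv_radius_A fps_conv_radius_C]
    by (rule less_le_trans[rotated]) simp
  have "eval_fps (A * C) z = eval_fps 1 z" if "z \<in> ball 0 1" for z
  proof -
    have z: "cmod z < 1"
      using that by simp
    then obtain r t where rt: "0 \<le> r" "r < 1" "z = of_real r * circ t"
      by (rule circ_surj)
    then have "mu_plus \<mu> z \<noteq> 0"
      using Re_mu_plus_ge_half[of r t] by auto
    then show ?thesis
      using z less_conv_radius[OF fps_conv_radius_A z] less_conv_radius[OF fps_conv_radius_C z]
      by (simp add: eval_fps_mult eval_A mu_plus_eq_eval_fps)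
  qed
  then show "\<forall>\<^sub>F z in nhds 0. eval_fps (A * C) z = eval_fps 1 z"
    unfolding eventually_nhds by (intro exI[of _ "ball 0 1"]) auto
qed simp

text \<open>Since |mu^+| >= Re mu^+, lower bounds for Re mu^+ become upper bounds for |1 - b| = 1 /
  |mu^+|. The product form of the second avoids dividing by a mass that may be 0.\<close>

lemma
  assumes r: "0 \<le> r" "r < 1"
  shows cmod_eval_A_le: "cmod (eval_fps A (of_real r * circ t)) \<le> 2"
    and cmod_eval_A_mult_le: "cmod (eval_fps A (of_real r * circ t)) *
      measure \<mu> ({t - (1 - r)..t + (1 - r)} \<inter> {0..<1}) \<le> 81 * (1 - r)"
proof -
  define m where "m = mu_plus \<mu> (of_real r * circ t)"
  have half: "1 / 2 \<le> cmod m"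
    using Re_mu_plus_ge_half[OF r, of t] complex_Re_le_cmod[of m] by (simp add: m_def)
  have A: "cmod (eval_fps A (of_real r * circ t)) = 1 / cmod m"
    using r by (simp add: eval_A norm_mult m_def norm_divide)
  show "cmod (eval_fps A (of_real r * circ t)) \<le> 2"
    using half frac_le[of 1 1 "1/2" "cmod m"] by (simp add: A)
  have "measure \<mu> ({t - (1 - r)..t + (1 - r)} \<inter> {0..<1}) / (81 * (1 - r)) \<le> cmod m"
    using Re_mu_plus_ge_near[OF r, of t] complex_Re_le_cmod[of m] by (simp add: m_def)
  then show "cmod (eval_fps A (of_real r * circ t)) *
      measure \<mu> ({t - (1 - r)..t + (1 - r)} \<inter> {0..<1}) \<le> 81 * (1 - r)"
    using half r unfolding A by (simp add: pos_divide_le_eq mult.commute) (simp add: divide_le_eq mult.commute)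
qed

lemma cmod_eval_A_sq_le:
  assumes r: "0 \<le> r" "r < 1"
  shows "(cmod (eval_fps A (of_real r * circ t)))\<^sup>2 \<le> 4"
proof -
  have "(cmod (eval_fps A (of_real r * circ t)))\<^sup>2 \<le> 2\<^sup>2"
    by (rule power_mono[OF cmod_eval_A_le[OF r] norm_ge_zero])
  also have "\<dots> = (4::real)"
    by simp
  finally show ?thesis .
qed

lemma borel_measurable_eval_A:
  assumes "0 \<le> r" "r < 1"
  shows "(\<lambda>t. eval_fps A (of_real r * circ t)) \<in> borel_measurable borel"
  using assms by (intro borel_measurable_continuous_onI continuous_on_eval_circ fps_conv_radius_A)

text \<open>Singularity of \<mu> enters here only. The choices run from \<open>e\<close> to the
  threshold \<open>d\<close>, then to the open set \<open>T\<close>, its inner part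
  \<open>W n\<close>, and last to the radii with 1 - r < \<open>h0\<close>.\<close>

lemma tendsto_integral_A:
  "((\<lambda>r. LINT t|\<mu>. (cmod (eval_fps A (of_real r * circ t)))\<^sup>2) \<longlongrightarrow> 0) (at_left 1)"
proof (rule tendstoI)
  fix e :: real assume e: "e > 0"
  \<comment> \<open>The budget: at most d^2 = e/4 from points where |1 - b| <= \<open>d\<close>, and
    at most 4 * e/16 from each of the exceptional sets \<open>F\<close> and \<open>V\<close>
    below.\<close>
  define d where "d = sqrt e / 2"
  \<comment> \<open>Where |1 - b| > \<open>d\<close>, \<open>cmod_eval_A_mult_le\<close> bounds the
    mass of the interval by (81 / d) (1 - r).\<close>
  define c where "c = 81 / d"
  have d: "d > 0" "d\<^sup>2 = e / 4"
    using e by (simp_all add: d_def power_divide)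
  have c: "c > 0"
    using d by (simp add: c_def)
  obtain N where N: "N \<in> sets \<mu>" "emeasure lborel N = 0" "emeasure \<mu> (space \<mu> - N) = 0"
    using sing by (auto simp: lebesgue_singular_def)
  obtain T where T: "open T" "N \<subseteq> T" "emeasure lborel T < ennreal (e / (16 * c))"
    using emeasure_lborel_outer_open[OF sets_mu_imp_borel[OF N(1)] N(2), of "e / (16 * c)"] e c
    by auto
  have Tfin: "emeasure lborel T < \<infinity>"
    using T(3) by (metis infinity_ennreal_def less_trans ennreal_less_top)
  have mT: "c * measure lborel T \<le> e / 16"
  proof -
    have "measure lborel T < e / (16 * c)"
      using T(3) Tfin e c by (simp add: emeasure_eq_ennreal_measure ennreal_less_iff)
    then show ?thesis
      using c by (simp add: field_simps)
  qed
  \<comment> \<open>\<open>infdist\<close> to the empty set is 0 by convention, so \<open>W\<close>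
    would be empty if \<open>T\<close> were the whole line.\<close>
  have neT: "- T \<noteq> {}"
  proof
    assume "- T = {}"
    then have "T = UNIV"
      by auto
    then show False
      using Tfin by simp
  qed
  \<comment> \<open>Around a point of \<open>W n\<close>, an interval of radius 1 - r < 1 / (n + 1)
    stays inside \<open>T\<close>. These sets exhaust \<open>T\<close>, which contains
    \<open>N\<close> and hence has full \<mu>-measure on [0,1).\<close>
  define W where "W n = {t. inverse (real (Suc n)) < infdist t (- T)}" for n
  have openW: "open (W n)" for n
    unfolding W_def by (intro open_Collect_less continuous_intros continuous_on_infdist)
  have UW: "(\<Union>n. W n) = T"
  proof -
    have "t \<in> T \<longleftrightarrow> 0 < infdist t (- T)" for t
      using in_closed_iff_infdist_zero[OF closed_Compl[OF T(1)] neT, of t]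
        infdist_nonneg[of t "- T"] by (auto simp: less_le)
    then show ?thesis
      using reals_Archimedean unfolding W_def
      by (auto, metis order.strict_trans inverse_positive_iff_positive of_nat_0_less_iff zero_less_Suc of_nat_Suc)
  qed
  have "(\<lambda>n. measure \<mu> (W n \<inter> {0..<1})) \<longlonglongrightarrow> measure \<mu> (\<Union>n. W n \<inter> {0..<1})"
  proof (rule finite_Lim_measure_incseq)
    show "incseq (\<lambda>n. W n \<inter> {0..<1})"
    proof (intro incseq_SucI Int_mono order_refl subsetI)
      fix n t assume "t \<in> W n"
      have "inverse (real (Suc (Suc n))) \<le> inverse (real (Suc n))"
        by (intro le_imp_inverse_le) auto
      also have "\<dots> < infdist t (- T)"
        using \<open>t \<in> W n\<close> by (simp add: W_def)
      finally show "t \<in> W (Suc n)"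
        by (simp add: W_def)
    qed
  qed (auto intro!: sets_mu_Int openW borel_open)
  also have "(\<Union>n. W n \<inter> {0..<1}) = T \<inter> {0..<1}"
    using UW by auto
  also have "measure \<mu> (T \<inter> {0..<1}) = 1"
  proof -
    have "measure \<mu> N = 1"
      using N prob_compl[of N] by (simp add: measure_def)
    moreover have "measure \<mu> N \<le> measure \<mu> (T \<inter> {0..<1})"
      using N T sets.sets_into_space[OF N(1)]
      by (intro finite_measure_mono sets_mu_Int) (auto simp: space_mu)
    ultimately show ?thesis
      using prob_le_1[of "T \<inter> {0..<1}"] by simp
  qed
  finally have "\<forall>\<^sub>F n in sequentially. 1 - e / 16 < measure \<mu> (W n \<inter> {0..<1})"
    using e by (intro order_tendstoD) auto
  then obtain n where n: "1 - e / 16 < measure \<mu> (W n \<inter> {0..<1})"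
    by (auto simp: eventually_sequentially)
  define h0 where "h0 = inverse (real (Suc n))"
  have h0: "0 < h0"
    by (simp add: h0_def)
  have bound: "(LINT t|\<mu>. (cmod (eval_fps A (of_real r * circ t)))\<^sup>2) < e"
    if r: "0 \<le> r" "r < 1" "1 - r < h0" for r
  proof -
    define g where "g t = cmod (eval_fps A (of_real r * circ t))" for t
    have g: "0 \<le> g t" "(g t)\<^sup>2 \<le> 4" for t
      using cmod_eval_A_sq_le r by (auto simp: g_def)
    have meas [measurable]: "g \<in> borel_measurable borel"
      unfolding g_def using r borel_measurable_eval_A by measurable
    \<comment> \<open>Outside \<open>F\<close> and \<open>V\<close> the modulus of 1 - b is at most
      \<open>d\<close>. The grid controls \<open>F\<close>, the choice of \<open>n\<close> controls
      \<open>V\<close>, and on both the square is at most 4.\<close>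
    define F where "F = {t. d < g t} \<inter> W n \<inter> {0..<1}"
    define V where "V = space \<mu> - W n \<inter> {0..<1}"
    have F: "F \<in> sets \<mu>"
    proof -
      have "{t. d < g t} \<in> sets borel"
        by measurable
      then show ?thesis
        unfolding F_def by (rule sets_mu_Int[OF sets.Int[OF _ borel_open[OF openW]]])
    qed
    have V: "V \<in> sets \<mu>"
      unfolding V_def using openW[of n] by (intro sets.compl_sets sets_mu_Int borel_open)
    have mF: "measure \<mu> F \<le> e / 16"
    proof -
      have "measure \<mu> F \<le> c * measure lborel T"
      proof (rule measure_le_grid[where h = "1 - r"])
        fix t assume t: "t \<in> F"
        show "{t - (1 - r)..t + (1 - r)} \<subseteq> T"
        proof
          fix s assume s: "s \<in> {t - (1 - r)..t + (1 - r)}"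
          show "s \<in> T"
          proof (rule ccontr)
            assume "s \<notin> T"
            then have "infdist t (- T) \<le> dist t s"
              by (intro infdist_le) auto
            also have "\<dots> \<le> 1 - r"
              using s by (auto simp: dist_real_def)
            finally show False
              using t r by (auto simp: F_def W_def h0_def)
          qed
        qed
        have "d * measure \<mu> ({t - (1 - r)..t + (1 - r)} \<inter> {0..<1}) \<le>
            g t * measure \<mu> ({t - (1 - r)..t + (1 - r)} \<inter> {0..<1})"
          using t by (intro mult_right_mono) (auto simp: F_def)
        also have "\<dots> \<le> 81 * (1 - r)"
          using cmod_eval_A_mult_le[of r t] r by (simp add: g_def)
        finally show "measure \<mu> ({t - (1 - r)..t + (1 - r)} \<inter> {0..<1}) \<le> c * (1 - r)"
          using d by (simp add: c_def field_simps)
      qed (use r c T Tfin in \<open>auto simp: F_def\<close>)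
      then show ?thesis
        using mT by simp
    qed
    have mV: "measure \<mu> V \<le> e / 16"
      using n prob_compl[of "W n \<inter> {0..<1}"] sets_mu_Int[of "W n"] openW[of n]
      by (simp add: V_def)
    have "(LINT t|\<mu>. (g t)\<^sup>2) \<le> (LINT t|\<mu>. d\<^sup>2 + (4 * indicator F t + 4 * indicator V t))"
    proof (rule integral_mono)
      show "integrable \<mu> (\<lambda>t. (g t)\<^sup>2)"
        using g by (intro integrable_mu_bounded[where B = 4] borel_measurable_mu) auto
      show "(g t)\<^sup>2 \<le> d\<^sup>2 + (4 * indicator F t + 4 * indicator V t)" if "t \<in> space \<mu>" for t
      proof (cases "t \<in> F \<or> t \<in> V")
        case True
        then have "4 \<le> 4 * indicator F t + 4 * (indicator V t :: real)"
          by (auto simp: indicator_def)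
        then show ?thesis
          using g(2)[of t] zero_le_power2[of d] by linarith
      next
        case False
        then have "g t \<le> d"
          using that by (auto simp: F_def V_def space_mu)
        then have "(g t)\<^sup>2 \<le> d\<^sup>2"
          using g(1) by (intro power_mono) auto
        then show ?thesis
          using False by simp
      qed
    qed (use F V in \<open>auto simp: less_top[symmetric]\<close>)
    also have "\<dots> = d\<^sup>2 + (4 * measure \<mu> F + 4 * measure \<mu> V)"
      using F V by (simp add: prob_space less_top[symmetric])
    also have "\<dots> < e"
      using mF mV d e by simp
    finally show ?thesis
      by (simp add: g_def)
  qed
  have "\<forall>\<^sub>F r in at_left 1. r \<in> {max 0 (1 - h0)<..<1::real}"
    using h0 by (intro eventually_at_leftI[of "max 0 (1 - h0)"]) auto
  then show "\<forall>\<^sub>F r in at_left 1. dist (LINT t|\<mu>. (cmod (eval_fps A (of_real r * circ t)))\<^sup>2) 0 < e"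
    by eventually_elim (use bound in \<open>auto simp: dist_real_def\<close>)
qed

end

section \<open>Abel means\<close>

lemma bounded_linear_scaleC: "bounded_linear (\<lambda>x::'a::complex_inner. c *\<^sub>C x)"
proof (rule bounded_linear_intro)
  show "c *\<^sub>C (s *\<^sub>R x) = s *\<^sub>R (c *\<^sub>C x)" for s and x :: 'a
    by (metis mult.commute scaleC_of_real scaleC_scaleC)
  show "norm (c *\<^sub>C x) \<le> norm x * cmod c" for x :: 'a
    by (simp add: norm_scaleC)
qed (rule scaleC_add_right)

section \<open>Linearity of Abel means and the series of inner products\<close>

context spectral_sequence
begin

lemma synth_add:
  assumes "fps_conv_radius f \<ge> 1" "fps_conv_radius g \<ge> 1" "0 \<le> r" "r < 1"
  shows "synth \<phi> r (f + g) = synth \<phi> r f + synth \<phi> r g"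
proof -
  have "(\<lambda>n. of_real (r ^ n) *\<^sub>C fps_nth (f + g) n *\<^sub>C \<phi> n) sums (synth \<phi> r f + synth \<phi> r g)"
    using sums_add[OF sums_synth[OF assms(1,3,4)] sums_synth[OF assms(2-4)]]
    by (simp add: scaleC_add_left scaleC_add_right)
  then show ?thesis
    unfolding synth_def by (rule sums_unique[symmetric])
qed

lemma synth_const_mult:
  assumes "fps_conv_radius f \<ge> 1" "0 \<le> r" "r < 1"
  shows "synth \<phi> r (fps_const c * f) = c *\<^sub>C synth \<phi> r f"
proof -
  have "(\<lambda>n. of_real (r ^ n) *\<^sub>C fps_nth (fps_const c * f) n *\<^sub>C \<phi> n) sums (c *\<^sub>C synth \<phi> r f)"
    using bounded_linear.sums[OF bounded_linear_scaleC sums_synth[OF assms], of c]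
    by (simp add: scaleC_scaleC mult_ac)
  then show ?thesis
    unfolding synth_def by (rule sums_unique[symmetric])
qed

lemma synth_X_power: "synth \<phi> r (fps_X ^ k) = of_real (r ^ k) *\<^sub>C \<phi> k"
proof -
  have "synth \<phi> r (fps_X ^ k) = (\<Sum>n\<in>{k}. of_real (r ^ n) *\<^sub>C fps_nth (fps_X ^ k) n *\<^sub>C \<phi> n)"
    unfolding synth_def by (rule suminf_finite) (auto simp: fps_X_power_nth)
  then show ?thesis
    by (simp add: fps_X_power_nth)
qed

text \<open>The product \<open>A * X x\<close> carries the noiseless coefficients of the
  theorem.\<close>

definition X where "X x = Abs_fps (\<lambda>n. cinner x (\<phi> n))"

lemma fps_conv_radius_X: "fps_conv_radius (X x) \<ge> 1"
  unfolding X_def by (rule fps_conv_radius_cinner)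

lemma X_add: "X (x + y) = X x + X y"
  by (simp add: X_def fps_eq_iff cinner_add_left)

lemma X_scaleC: "X (c *\<^sub>C x) = fps_const c * X x"
  by (simp add: X_def fps_eq_iff cinner_scaleC_left)

text \<open>From index \<open>k\<close> on, stationarity turns the coefficients into
  autocorrelations shifted by \<open>k\<close>; the earlier ones form a polynomial. Multiplication
  by \<open>A\<close> then reduces the shifted part to \<open>fps_X ^ k\<close>.\<close>

lemma X_phi: "X (\<phi> k) = Abs_fps (\<lambda>n. if n < k then cinner (\<phi> k) (\<phi> n) else 0) + fps_X ^ k * C"
proof -
  have "cinner (\<phi> k) (\<phi> n) = cinner (\<phi> 0) (\<phi> (n - k))" if "k \<le> n" for n
    using cinner_phi_shift[of 0 k "n - k"] that by simp
  then show ?thesis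
    by (simp add: X_def C_def fps_eq_iff fps_X_power_mult_nth)
qed

end

section \<open>Vanishing of the noise and recovery of the signal\<close>

context singular_spectral_sequence
begin

lemma fps_conv_radius_A_mult: "fps_conv_radius f \<ge> 1 \<Longrightarrow> fps_conv_radius (A * f) \<ge> 1"
  using fps_conv_radius_A by (rule fps_conv_radius_mult_ge_1)

lemma norm_synth_A_mult:
  assumes "fps_conv_radius f \<ge> 1" "0 \<le> r" "r < 1"
  shows "(norm (synth \<phi> r (A * f)))\<^sup>2 =
    (LINT t|\<mu>. (cmod (eval_fps A (of_real r * circ t)))\<^sup>2 * (cmod (eval_fps f (of_real r * circ t)))\<^sup>2)"
proof -
  have "eval_fps (A * f) (of_real r * circ t) =
      eval_fps A (of_real r * circ t) * eval_fps f (of_real r * circ t)" for t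
    using assms by (intro eval_fps_mult less_conv_radius fps_conv_radius_A) (auto simp: norm_mult)
  then show ?thesis
    using assms
    by (simp add: norm_synth fps_conv_radius_A_mult norm_mult power_mult_distrib)
qed

lemma eventually_at_left_1: "\<forall>\<^sub>F r in at_left 1. 0 \<le> r \<and> r < (1::real)"
  by (rule eventually_at_leftI[of 0]) auto

lemma tendsto_synth_zeroI:
  assumes le: "\<And>r. 0 \<le> r \<Longrightarrow> r < 1 \<Longrightarrow> (norm (synth \<phi> r f))\<^sup>2 \<le> h r"
    and h: "(h \<longlongrightarrow> 0) (at_left 1)"
  shows "((\<lambda>r. synth \<phi> r f) \<longlongrightarrow> 0) (at_left 1)"
proof -
  have "((\<lambda>r. (norm (synth \<phi> r f))\<^sup>2) \<longlongrightarrow> 0) (at_left 1)"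
  proof (rule tendsto_sandwich[OF _ _ tendsto_const h])
    show "\<forall>\<^sub>F r in at_left 1. (norm (synth \<phi> r f))\<^sup>2 \<le> h r"
      using eventually_at_left_1 by eventually_elim (simp add: le)
  qed simp
  from tendsto_real_sqrt[OF this] show ?thesis
    by (simp add: tendsto_norm_zero_iff)
qed

lemma integrable_A_mult:
  assumes r: "0 \<le> r" "r < 1" and u: "integrable \<mu> u"
  shows "integrable \<mu> (\<lambda>t. (cmod (eval_fps A (of_real r * circ t)))\<^sup>2 * u t :: real)"
proof (rule Bochner_Integration.integrable_bound)
  show "integrable \<mu> (\<lambda>t. 4 * u t)"
    using u by simp
  have "(\<lambda>t. (cmod (eval_fps A (of_real r * circ t)))\<^sup>2) \<in> borel_measurable \<mu>"
    using borel_measurable_eval_A[OF r] by (intro borel_measurable_mu) measurable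
  then show "(\<lambda>t. (cmod (eval_fps A (of_real r * circ t)))\<^sup>2 * u t) \<in> borel_measurable \<mu>"
    using borel_measurable_integrable[OF u] by (intro borel_measurable_times)
  show "AE t in \<mu>. norm ((cmod (eval_fps A (of_real r * circ t)))\<^sup>2 * u t) \<le> norm (4 * u t)"
  proof (rule AE_I2)
    fix t
    show "norm ((cmod (eval_fps A (of_real r * circ t)))\<^sup>2 * u t) \<le> norm (4 * u t)"
      using mult_right_mono[OF cmod_eval_A_sq_le[OF r, of t] abs_ge_zero[of "u t"]]
      by (simp only: real_norm_def abs_mult abs_power2 abs_numeral)
  qed
qed

text \<open>Decay of 1 - b is known in mean square, not almost everywhere, so the weight
  \<open>u\<close> is truncated at a level \<open>K\<close>. The excess over \<open>K\<close> costs
  at most 4 times a small integral, and the bounded part is \<open>K\<close> times the unweighted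
  case.\<close>

lemma tendsto_integral_A_mult:
  fixes u :: "real \<Rightarrow> real"
  assumes u: "integrable \<mu> u" and nonneg: "\<And>t. 0 \<le> u t"
  shows "((\<lambda>r. LINT t|\<mu>. (cmod (eval_fps A (of_real r * circ t)))\<^sup>2 * u t) \<longlongrightarrow> 0) (at_left 1)"
proof (rule tendstoI)
  fix e :: real assume e: "e > 0"
  have [measurable]: "u \<in> borel_measurable \<mu>"
    using u by (rule borel_measurable_integrable)
  have "(\<lambda>K. LINT t|\<mu>. u t - min (u t) (real K)) \<longlonglongrightarrow> (LINT t|\<mu>. 0)"
  proof (rule integral_dominated_convergence[where w = u])
    show "AE t in \<mu>. (\<lambda>K. u t - min (u t) (real K)) \<longlonglongrightarrow> 0"
    proof (rule AE_I2, rule tendsto_eventually)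
      fix t
      have "\<forall>\<^sub>F K in sequentially. u t \<le> real K"
        using filterlim_real_sequentially by (auto simp: filterlim_at_top)
      then show "\<forall>\<^sub>F K in sequentially. u t - min (u t) (real K) = 0"
        by eventually_elim simp
    qed
    show "AE t in \<mu>. norm (u t - min (u t) (real K)) \<le> u t" for K
      using nonneg by (intro AE_I2) (auto simp: min_def)
  qed (use u in auto)
  then have "\<forall>\<^sub>F K in sequentially. (LINT t|\<mu>. u t - min (u t) (real K)) < e / 8"
    using e by (intro order_tendstoD) auto
  \<comment> \<open>The factor 4 turns e/8 into half of the allowed error.\<close>
  then obtain K :: nat where K: "(LINT t|\<mu>. u t - min (u t) (real K)) < e / 8"
    by (auto simp: eventually_sequentially)
  have int: "integrable \<mu> (\<lambda>t. u t - min (u t) (real K))"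
    using u nonneg by (rule_tac Bochner_Integration.integrable_bound[OF u]) (auto simp: min_def)
  have bound: "(LINT t|\<mu>. (cmod (eval_fps A (of_real r * circ t)))\<^sup>2 * u t) \<le>
      4 * (LINT t|\<mu>. u t - min (u t) (real K)) +
      real K * (LINT t|\<mu>. (cmod (eval_fps A (of_real r * circ t)))\<^sup>2)"
    if r: "0 \<le> r" "r < 1" for r
  proof -
    define g where "g t = (cmod (eval_fps A (of_real r * circ t)))\<^sup>2" for t
    have g: "0 \<le> g t" "g t \<le> 4" for t
      using cmod_eval_A_sq_le[OF r] by (auto simp: g_def)
    have intg: "integrable \<mu> g"
      using integrable_A_mult[OF r, of "\<lambda>_. 1"] by (simp add: g_def[abs_def])
    have "(LINT t|\<mu>. g t * u t) \<le> (LINT t|\<mu>. 4 * (u t - min (u t) (real K)) + real K * g t)"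
    proof (rule integral_mono)
      show "integrable \<mu> (\<lambda>t. g t * u t)"
        unfolding g_def by (rule integrable_A_mult[OF r u])
      show "g t * u t \<le> 4 * (u t - min (u t) (real K)) + real K * g t" for t
      proof -
        have "g t * (u t - min (u t) (real K)) \<le> 4 * (u t - min (u t) (real K))"
          using g by (intro mult_right_mono) auto
        moreover have "g t * min (u t) (real K) \<le> g t * real K"
          using g by (intro mult_left_mono) auto
        ultimately show ?thesis
          by (simp add: algebra_simps)
      qed
      show "integrable \<mu> (\<lambda>t. 4 * (u t - min (u t) (real K)) + real K * g t)"
        by (intro Bochner_Integration.integrable_add integrable_mult_right int intg)
    qed
    also have "\<dots> = 4 * (LINT t|\<mu>. u t - min (u t) (real K)) + real K * (LINT t|\<mu>. g t)"
      by (simp only: Bochner_Integration.integral_add integrable_mult_right int intg integral_mult_right_zero)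
    finally show ?thesis
      by (simp add: g_def)
  qed
  \<comment> \<open>The denominator has K + 1 because \<open>K\<close> may be 0.\<close>
  have "\<forall>\<^sub>F r in at_left 1. (LINT t|\<mu>. (cmod (eval_fps A (of_real r * circ t)))\<^sup>2) < e / (2 * (real K + 1))"
    using e by (intro order_tendstoD(2)[OF tendsto_integral_A]) auto
  then show "\<forall>\<^sub>F r in at_left 1.
      dist (LINT t|\<mu>. (cmod (eval_fps A (of_real r * circ t)))\<^sup>2 * u t) 0 < e"
    using eventually_at_left_1
  proof eventually_elim
    case (elim r)
    define I where "I = (LINT t|\<mu>. (cmod (eval_fps A (of_real r * circ t)))\<^sup>2)"
    have "0 \<le> I"
      unfolding I_def by (rule integral_nonneg_AE) simp
    have "real K * I \<le> (real K + 1) * I"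
      using \<open>0 \<le> I\<close> by (intro mult_right_mono) auto
    also have "\<dots> < e / 2"
      using elim by (simp add: I_def field_simps)
    finally have "(LINT t|\<mu>. (cmod (eval_fps A (of_real r * circ t)))\<^sup>2 * u t) < e"
      using bound[of r] elim K by (simp add: I_def)
    moreover have "0 \<le> (LINT t|\<mu>. (cmod (eval_fps A (of_real r * circ t)))\<^sup>2 * u t)"
      using nonneg by (intro integral_nonneg_AE) auto
    ultimately show ?case
      by simp
  qed
qed

text \<open>On the circle of radius \<open>r\<close> the series \<open>f\<close> is replaced by its
  boundary value \<open>v\<close>. By |a + b|^2 <= 2 |a|^2 + 2 |b|^2 and |1 - b|^2 <= 4 this costs 8
  (D r)^2; what remains is |1 - b|^2 against the fixed integrable weight |v|^2.\<close>

lemma tendsto_synth_A_mult_zero: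
  assumes f: "fps_conv_radius f \<ge> 1" and v: "L2_fun \<mu> v"
    and lim: "((\<lambda>r. L2_norm \<mu> (\<lambda>t. eval_fps f (of_real r * circ t) - v t)) \<longlongrightarrow> 0) (at_left 1)"
  shows "((\<lambda>r. synth \<phi> r (A * f)) \<longlongrightarrow> 0) (at_left 1)"
proof -
  define D where "D r = L2_norm \<mu> (\<lambda>t. eval_fps f (of_real r * circ t) - v t)" for r
  define J where "J r = (LINT t|\<mu>. (cmod (eval_fps A (of_real r * circ t)))\<^sup>2 * (cmod (v t))\<^sup>2)" for r
  have v': "v \<in> borel_measurable \<mu>" "integrable \<mu> (\<lambda>t. (cmod (v t))\<^sup>2)"
    using v by (auto simp: L2_fun_def)
  have sq: "(cmod (a + b))\<^sup>2 \<le> 2 * (cmod a)\<^sup>2 + 2 * (cmod b)\<^sup>2" for a b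
  proof -
    have "(cmod (a + b))\<^sup>2 \<le> (cmod a + cmod b)\<^sup>2"
      by (intro power_mono norm_triangle_ineq) auto
    also have "\<dots> \<le> 2 * (cmod a)\<^sup>2 + 2 * (cmod b)\<^sup>2"
      using zero_le_power2[of "cmod a - cmod b"] by (simp add: power2_eq_square algebra_simps)
    finally show ?thesis .
  qed
  have bound: "(norm (synth \<phi> r (A * f)))\<^sup>2 \<le> 8 * (D r)\<^sup>2 + 2 * J r" if r: "0 \<le> r" "r < 1" for r
  proof -
    define g where "g t = (cmod (eval_fps A (of_real r * circ t)))\<^sup>2" for t
    define F where "F t = eval_fps f (of_real r * circ t)" for t
    have g: "0 \<le> g t" "g t \<le> 4" for t
      using cmod_eval_A_sq_le[OF r] by (auto simp: g_def)
    have contF: "continuous_on UNIV F"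
      unfolding F_def by (rule continuous_on_eval_circ[OF f r])
    then have F: "F \<in> borel_measurable \<mu>"
      by (rule borel_measurable_mu_continuous)
    obtain B where B: "cmod (F t) \<le> B" for t
    proof
      show "cmod (F t) \<le> (\<Sum>n. norm (fps_nth f n * of_real r ^ n))" for t
      proof -
        have "summable (\<lambda>n. norm (fps_nth f n * of_real r ^ n))"
          using f r less_conv_radius[of f "of_real r"]
          by (intro abs_summable_in_conv_radius) (auto simp: fps_conv_radius_def)
        then have "summable (\<lambda>n. norm (fps_nth f n * (of_real r * circ t) ^ n))"
          by (simp add: norm_mult norm_power power_mult_distrib)
        from summable_norm[OF this] show ?thesis
          by (simp add: F_def eval_fps_def norm_mult norm_power power_mult_distrib)
      qed
    qed
    have intF: "integrable \<mu> (\<lambda>t. (cmod (F t))\<^sup>2)"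
      using F B by (intro integrable_mu_bounded[where B = "B\<^sup>2"]) (auto intro!: power_mono)
    \<comment> \<open>A non-integrable function would have integral 0 by convention, and
      \<open>D r\<close> would then bound nothing.\<close>
    have intD: "integrable \<mu> (\<lambda>t. (cmod (F t - v t))\<^sup>2)"
    proof (rule Bochner_Integration.integrable_bound)
      show "integrable \<mu> (\<lambda>t. 2 * (cmod (F t))\<^sup>2 + 2 * (cmod (v t))\<^sup>2)"
        using intF v' by simp
      show "AE t in \<mu>. norm ((cmod (F t - v t))\<^sup>2) \<le> norm (2 * (cmod (F t))\<^sup>2 + 2 * (cmod (v t))\<^sup>2)"
        using sq[of "F t" "- v t" for t] by (intro AE_I2) simp
    qed (use F v' in measurable)
    have "(norm (synth \<phi> r (A * f)))\<^sup>2 = (LINT t|\<mu>. g t * (cmod (F t))\<^sup>2)"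
      by (simp add: norm_synth_A_mult[OF f r] g_def F_def)
    also have "\<dots> \<le> (LINT t|\<mu>. 8 * (cmod (F t - v t))\<^sup>2 + 2 * (g t * (cmod (v t))\<^sup>2))"
    proof (rule integral_mono)
      show "g t * (cmod (F t))\<^sup>2 \<le> 8 * (cmod (F t - v t))\<^sup>2 + 2 * (g t * (cmod (v t))\<^sup>2)" for t
      proof -
        have "g t * (cmod (F t))\<^sup>2 \<le> g t * (2 * (cmod (F t - v t))\<^sup>2 + 2 * (cmod (v t))\<^sup>2)"
          using g sq[of "F t - v t" "v t"] by (intro mult_left_mono) auto
        moreover have "g t * (cmod (F t - v t))\<^sup>2 \<le> 4 * (cmod (F t - v t))\<^sup>2"
          using g by (intro mult_right_mono) auto
        ultimately show ?thesis
          by (simp add: algebra_simps)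
      qed
    qed (use intD integrable_A_mult[OF r intF] integrable_A_mult[OF r v'(2)] in \<open>auto simp: g_def\<close>)
    also have "\<dots> = 8 * (LINT t|\<mu>. (cmod (F t - v t))\<^sup>2) + 2 * J r"
      using intD integrable_A_mult[OF r v'(2)] by (simp add: g_def J_def)
    also have "(LINT t|\<mu>. (cmod (F t - v t))\<^sup>2) = (D r)\<^sup>2"
      by (simp add: D_def L2_norm_def F_def)
    finally show ?thesis .
  qed
  have "((\<lambda>r. 8 * (D r)\<^sup>2 + 2 * J r) \<longlongrightarrow> 8 * 0\<^sup>2 + 2 * 0) (at_left 1)"
    using lim unfolding D_def[symmetric]
    by (intro tendsto_intros) (use tendsto_integral_A_mult[OF v'(2)] in \<open>auto simp: J_def\<close>)
  then show ?thesis
    by (intro tendsto_synth_zeroI[OF bound]) simp_all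
qed

text \<open>A polynomial is bounded on the disc, so \<open>tendsto_integral_A\<close> suffices. It
  disposes of the polynomial part of \<open>X_phi\<close>.\<close>

lemma tendsto_synth_A_mult_finite:
  fixes p :: "nat \<Rightarrow> complex"
  shows "((\<lambda>r. synth \<phi> r (A * Abs_fps (\<lambda>n. if n < k then p n else 0))) \<longlongrightarrow> 0) (at_left 1)"
proof -
  define f where "f = Abs_fps (\<lambda>n. if n < k then p n else 0)"
  define B where "B = (\<Sum>n<k. cmod (p n))"
  have f: "fps_conv_radius f \<ge> 1"
  proof (rule fps_conv_radius_bounded[where B = B])
    show "cmod (fps_nth f n) \<le> B" for n
      using member_le_sum[of n "{..<k}" "\<lambda>n. cmod (p n)"] sum_nonneg[of "{..<k}" "\<lambda>n. cmod (p n)"]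
      by (auto simp: f_def B_def)
  qed
  have B: "cmod (eval_fps f z) \<le> B" if "cmod z \<le> 1" for z
  proof -
    have "eval_fps f z = (\<Sum>n<k. p n * z ^ n)"
      unfolding eval_fps_def
      by (subst suminf_finite[of "{..<k}"]) (auto simp: f_def)
    also have "cmod \<dots> \<le> B"
      unfolding B_def using that
      by (intro sum_norm_le) (simp add: norm_mult norm_power power_le_one mult_left_le)
    finally show ?thesis .
  qed
  have bound: "(norm (synth \<phi> r (A * f)))\<^sup>2 \<le> B\<^sup>2 * (LINT t|\<mu>. (cmod (eval_fps A (of_real r * circ t)))\<^sup>2)"
    if r: "0 \<le> r" "r < 1" for r
  proof -
    have "(norm (synth \<phi> r (A * f)))\<^sup>2 \<le> (LINT t|\<mu>. (cmod (eval_fps A (of_real r * circ t)))\<^sup>2 * B\<^sup>2)"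
      unfolding norm_synth_A_mult[OF f r]
    proof (rule integral_mono)
      have le: "(cmod (eval_fps f (of_real r * circ t)))\<^sup>2 \<le> B\<^sup>2" for t
        using B[of "of_real r * circ t"] r by (intro power_mono) (auto simp: norm_mult)
      then show "(cmod (eval_fps A (of_real r * circ t)))\<^sup>2 * (cmod (eval_fps f (of_real r * circ t)))\<^sup>2
          \<le> (cmod (eval_fps A (of_real r * circ t)))\<^sup>2 * B\<^sup>2" for t
        by (intro mult_left_mono) auto
      have "(\<lambda>t. (cmod (eval_fps f (of_real r * circ t)))\<^sup>2) \<in> borel_measurable \<mu>"
        by (intro borel_measurable_mu_continuous continuous_on_power continuous_on_norm
            continuous_on_eval_circ[OF f r])
      then have "integrable \<mu> (\<lambda>t. (cmod (eval_fps f (of_real r * circ t)))\<^sup>2)"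
        using le by (rule_tac integrable_mu_bounded[where B = "B\<^sup>2"]) auto
      then show "integrable \<mu> (\<lambda>t. (cmod (eval_fps A (of_real r * circ t)))\<^sup>2 *
          (cmod (eval_fps f (of_real r * circ t)))\<^sup>2)"
        by (rule integrable_A_mult[OF r])
      show "integrable \<mu> (\<lambda>t. (cmod (eval_fps A (of_real r * circ t)))\<^sup>2 * B\<^sup>2)"
        by (rule integrable_A_mult[OF r]) simp
    qed
    then show ?thesis
      by (simp add: mult.commute)
  qed
  have "((\<lambda>r. B\<^sup>2 * (LINT t|\<mu>. (cmod (eval_fps A (of_real r * circ t)))\<^sup>2)) \<longlongrightarrow> B\<^sup>2 * 0) (at_left 1)"
    by (intro tendsto_intros tendsto_integral_A)
  then show ?thesis
    unfolding f_def[symmetric] by (intro tendsto_synth_zeroI[OF bound]) simp_all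
qed

text \<open>The coefficients of \<open>A * X x\<close> are those of the Kaczmarz iteration: each partial sum adds the
  projection of the current error onto the next \<open>\<phi> n\<close>, so the error never grows.\<close>

lemma norm_kaczmarz_sum_le:
  "norm (\<Sum>i<n. fps_nth (A * X x) i *\<^sub>C \<phi> i) \<le> 2 * norm x"
proof -
  define c where "c = fps_nth (A * X x)"
  define y where "y n = (\<Sum>i<n. c i *\<^sub>C \<phi> i)" for n
  have X: "X x = (A * X x) * C"
    using A_times_C by (simp add: mult_ac)
  \<comment> \<open>In the convolution X x = (A * X x) * C, the top term is \<open>c n\<close>
    because \<phi> n is a unit vector, and the lower terms add up to the inner product of
    \<open>y n\<close> with \<phi> n.\<close>
  have c: "c n = cinner (x - y n) (\<phi> n)" for n
  proof -
    have "cinner x (\<phi> n) = fps_nth (A * X x * C) n"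
      unfolding X[symmetric] by (simp add: X_def)
    also have "\<dots> = (\<Sum>i\<in>{..n}. c i * cinner (\<phi> i) (\<phi> n))"
      unfolding fps_mult_nth[of "A * X x"] c_def atLeast0AtMost
    proof (rule sum.cong[OF refl])
      fix i assume "i \<in> {..n}"
      then show "fps_nth (A * X x) i * fps_nth C (n - i) = fps_nth (A * X x) i * cinner (\<phi> i) (\<phi> n)"
        using cinner_phi_shift[of 0 i "n - i"] by (simp add: C_def)
    qed
    also have "\<dots> = (\<Sum>i<n. c i * cinner (\<phi> i) (\<phi> n)) + c n"
      by (simp add: lessThan_Suc_atMost[symmetric] cinner_eq_norm norm_phi)
    finally show ?thesis
      by (simp add: y_def cinner_diff_left cinner_sum_left cinner_scaleC_left)
  qed
  have "norm (x - y n) \<le> norm x"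
  proof (induction n)
    case (Suc n)
    have eq: "x - y (Suc n) = (x - y n) - cinner (x - y n) (\<phi> n) *\<^sub>C \<phi> n"
      unfolding c[symmetric] by (simp add: y_def)
    show ?case
      unfolding eq by (rule order_trans[OF norm_diff_projection_le[OF norm_phi] Suc])
  qed (simp add: y_def)
  then have "norm (y n) \<le> 2 * norm x"
    using norm_triangle_ineq4[of x "x - y n"] by simp
  then show ?thesis
    by (simp add: y_def c_def)
qed

text \<open>Summation by parts: an Abel mean averages the partial sums with nonnegative weights, so
  it inherits their bound.\<close>

lemma norm_synth_X_le:
  assumes r: "0 \<le> r" "r < 1"
  shows "norm (synth \<phi> r (A * X x)) \<le> 2 * norm x"
proof -
  define B where "B = 2 * norm x"
  define y where "y n = (\<Sum>i<n. fps_nth (A * X x) i *\<^sub>C \<phi> i)" for n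
  define s where "s n = (\<Sum>i<n. of_real (r ^ i) *\<^sub>C fps_nth (A * X x) i *\<^sub>C \<phi> i)" for n
  have y: "norm (y n) \<le> B" for n
    unfolding y_def B_def by (rule norm_kaczmarz_sum_le)
  \<comment> \<open>The weights r^i - r^(i+1) for i < n add up to 1 - r^n; the boundary term
    \<open>r ^ n *\<^sub>R y n\<close> carries the rest.\<close>
  have abel: "norm (s n - r ^ n *\<^sub>R y n) \<le> B * (1 - r ^ n)" for n
  proof (induction n)
    case (Suc n)
    have "s (Suc n) = s n + r ^ n *\<^sub>R (y (Suc n) - y n)"
      by (simp add: s_def y_def scaleC_of_real del: of_real_power scaleC.scale_scale)
    then have "s (Suc n) - r ^ Suc n *\<^sub>R y (Suc n) = (s n - r ^ n *\<^sub>R y n) + (r ^ n - r ^ Suc n) *\<^sub>R y (Suc n)"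
      by (simp only: scaleR_diff_left scaleR_diff_right) simp
    also have "norm \<dots> \<le> B * (1 - r ^ n) + (r ^ n - r ^ Suc n) * B"
    proof (rule norm_triangle_le[OF add_mono[OF Suc]])
      have "0 \<le> r ^ n - r ^ Suc n"
        using r by (simp add: mult_left_le_one_le)
      then show "norm ((r ^ n - r ^ Suc n) *\<^sub>R y (Suc n)) \<le> (r ^ n - r ^ Suc n) * B"
        using y[of "Suc n"] by (simp only: norm_scaleR abs_of_nonneg mult_left_mono)
    qed
    finally show ?case
      by (simp add: algebra_simps)
  qed (simp add: s_def y_def)
  have "norm (s n) \<le> B" for n
  proof -
    have "norm (s n) \<le> norm (s n - r ^ n *\<^sub>R y n) + norm (r ^ n *\<^sub>R y n)"
      using norm_triangle_ineq[of "s n - r ^ n *\<^sub>R y n" "r ^ n *\<^sub>R y n"] by simp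
    also have "\<dots> \<le> B * (1 - r ^ n) + r ^ n * B"
      using r y[of n] abel[of n] by (intro add_mono) (auto intro: mult_left_mono)
    finally show ?thesis
      by (simp add: algebra_simps)
  qed
  moreover have "(\<lambda>n. norm (s n)) \<longlonglongrightarrow> norm (synth \<phi> r (A * X x))"
    using sums_synth[OF fps_conv_radius_A_mult[OF fps_conv_radius_X] r, of x]
    unfolding sums_def s_def by (rule tendsto_norm)
  ultimately show ?thesis
    unfolding B_def by (intro LIMSEQ_le_const2) auto
qed

text \<open>By linearity only \<phi> k matters. There \<open>X_phi\<close> and
  \<open>A_times_C\<close> give z^k plus \<open>A\<close> times a polynomial: the first has Abel
  mean r^k \<phi> k, and the mean of the second vanishes in the limit.\<close>

lemma tendsto_synth_X_span:
  assumes "x \<in> scaleC.span (range \<phi>)"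
  shows "((\<lambda>r. synth \<phi> r (A * X x)) \<longlongrightarrow> x) (at_left 1)"
  using assms
proof (induction rule: scaleC.span_induct_alt)
  case base
  have "X 0 = 0"
    by (simp add: X_def fps_eq_iff)
  then show ?case
    by (simp add: synth_def)
next
  case (step c z y)
  then obtain k where z: "z = \<phi> k"
    by auto
  define P where "P = Abs_fps (\<lambda>n. if n < k then cinner (\<phi> k) (\<phi> n) else 0)"
  have P: "fps_conv_radius P \<ge> 1"
    by (rule fps_conv_radius_bounded[where B = 1])
      (use cmod_cinner_le[OF norm_phi, of "\<phi> k"] norm_phi in \<open>auto simp: P_def\<close>)
  have AX: "A * X z = A * P + fps_X ^ k"
  proof -
    have "A * X z = A * P + fps_X ^ k * (A * C)"
      unfolding z X_phi P_def[symmetric] by (simp add: algebra_simps)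
    then show ?thesis
      by (simp add: A_times_C)
  qed
  have "((\<lambda>r. c *\<^sub>C (synth \<phi> r (A * P) + r ^ k *\<^sub>R \<phi> k) + synth \<phi> r (A * X y))
      \<longlongrightarrow> c *\<^sub>C (0 + 1 ^ k *\<^sub>R \<phi> k) + y) (at_left 1)"
    unfolding P_def
    by (intro tendsto_add tendsto_synth_A_mult_finite step.IH tendsto_intros
        bounded_linear.tendsto[OF bounded_linear_scaleC])
  moreover have "\<forall>\<^sub>F r in at_left 1. c *\<^sub>C (synth \<phi> r (A * P) + r ^ k *\<^sub>R \<phi> k) + synth \<phi> r (A * X y)
      = synth \<phi> r (A * X (c *\<^sub>C z + y))"
    using eventually_at_left_1
  proof eventually_elim
    case (elim r)
    have "A * X (c *\<^sub>C z + y) = fps_const c * (A * X z) + A * X y"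
      by (simp add: X_add X_scaleC algebra_simps)
    moreover have "fps_conv_radius (fps_const c * (A * X z)) \<ge> 1"
      by (intro fps_conv_radius_mult_ge_1 fps_conv_radius_A fps_conv_radius_X) simp
    ultimately have "synth \<phi> r (A * X (c *\<^sub>C z + y)) = c *\<^sub>C synth \<phi> r (A * X z) + synth \<phi> r (A * X y)"
      using elim by (simp add: synth_add synth_const_mult fps_conv_radius_A_mult fps_conv_radius_X)
    also have "synth \<phi> r (A * X z) = synth \<phi> r (A * P) + r ^ k *\<^sub>R \<phi> k"
      unfolding AX using elim
      by (simp add: synth_add fps_conv_radius_A_mult P synth_X_power scaleC_of_real del: of_real_power)
    finally show ?case
      by simp
  qed
  ultimately show ?case
    using z by (simp add: tendsto_cong)
qed

lemma tendsto_synth_X: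
  assumes dense: "linearly_dense \<phi>"
  shows "((\<lambda>r. synth \<phi> r (A * X x)) \<longlongrightarrow> x) (at_left 1)"
proof (rule tendstoI)
  fix e :: real assume e: "e > 0"
  have "x \<in> closure (scaleC.span (range \<phi>))"
    using dense by (simp add: linearly_dense_def)
  \<comment> \<open>The factor 2 in \<open>norm_synth_X_le\<close> makes the error of x - y less
    than e/2; the two other errors are less than e/4 each.\<close>
  then obtain y where y: "y \<in> scaleC.span (range \<phi>)" "dist y x < e / 4"
    using e unfolding closure_approachable by (meson divide_pos_pos zero_less_numeral)
  have "\<forall>\<^sub>F r in at_left 1. dist (synth \<phi> r (A * X y)) y < e / 4"
    using e by (intro tendstoD[OF tendsto_synth_X_span[OF y(1)]]) simp
  then show "\<forall>\<^sub>F r in at_left 1. dist (synth \<phi> r (A * X x)) x < e"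
    using eventually_at_left_1
  proof eventually_elim
    case (elim r)
    have "A * X x = A * X (x - y) + A * X y"
      using X_add[of "x - y" y] by (simp add: algebra_simps)
    then have "synth \<phi> r (A * X x) - x = synth \<phi> r (A * X (x - y)) + ((synth \<phi> r (A * X y) - y) + (y - x))"
      using elim by (simp add: synth_add fps_conv_radius_A_mult fps_conv_radius_X)
    also have "norm \<dots> \<le> norm (synth \<phi> r (A * X (x - y))) + (norm (synth \<phi> r (A * X y) - y) + norm (y - x))"
      by (intro norm_triangle_le add_left_mono norm_triangle_ineq)
    also have "\<dots> < e"
      using norm_synth_X_le[of r "x - y"] elim y(2) by (simp add: dist_norm norm_minus_commute)
    finally show ?case
      by (simp add: dist_norm)
  qed
qed

end

text \<open>Summability is asserted along with each limit, since \<open>suminf\<close> of a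
  divergent series is an unspecified value. The second limit is the sum of the noiseless limit and
  the first.\<close>

theorem theorem3:
  fixes \<phi> :: "nat \<Rightarrow> 'a::complex_hilbert_space"
    and x :: 'a
    and \<mu> :: "real measure"
    and \<alpha> \<epsilon> :: "nat \<Rightarrow> complex"
    and \<epsilon>_star :: "real \<Rightarrow> complex"
  assumes "stationary \<phi>"
    and "linearly_dense \<phi>"
    and "is_spectral_measure \<phi> \<mu>"
    and "lebesgue_singular \<mu>"
    and "is_coeff_seq \<mu> \<alpha>"
    and "conv_radius \<epsilon> \<ge> 1"
    and "has_L2_boundary (power_series \<epsilon>) \<mu> \<epsilon>_star"
  shows "(\<forall>r\<in>{0..<1::real}. summable (\<lambda>n. of_real (r ^ n) *\<^sub>C (\<Sum>j\<le>n. \<alpha> (n - j) * \<epsilon> j) *\<^sub>C \<phi> n)) \<and>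
    ((\<lambda>r::real. norm (\<Sum>n. of_real (r ^ n) *\<^sub>C (\<Sum>j\<le>n. \<alpha> (n - j) * \<epsilon> j) *\<^sub>C \<phi> n))
      \<longlongrightarrow> 0) (at_left 1) \<and>
    (\<forall>r\<in>{0..<1::real}. summable (\<lambda>n. of_real (r ^ n) *\<^sub>C
      (\<Sum>j\<le>n. \<alpha> (n - j) * (cinner x (\<phi> j) + \<epsilon> j)) *\<^sub>C \<phi> n)) \<and>
    ((\<lambda>r::real. \<Sum>n. of_real (r ^ n) *\<^sub>C
      (\<Sum>j\<le>n. \<alpha> (n - j) * (cinner x (\<phi> j) + \<epsilon> j)) *\<^sub>C \<phi> n)
      \<longlongrightarrow> x) (at_left 1)"
proof -
  interpret prob_space \<mu>
    using assms(3) by (simp add: is_spectral_measure_def)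
  interpret singular_spectral_sequence \<mu> \<phi> \<alpha>
    by unfold_locales (use assms in auto)
  define E where "E = Abs_fps \<epsilon>"
  have E: "fps_conv_radius E \<ge> 1"
    using assms(6) by (simp add: E_def fps_conv_radius_def)
  have XE: "fps_conv_radius (X x + E) \<ge> 1"
    using fps_conv_radius_add[of "X x" E] E fps_conv_radius_X[of x]
    by (meson min.boundedI order_trans)
  \<comment> \<open>\<open>fps_mult_nth\<close> puts the index n - j on the second factor, so the
    factors are swapped to place it on \<alpha>.\<close>
  have nth: "fps_nth (A * f) n = (\<Sum>j\<le>n. \<alpha> (n - j) * fps_nth f j)" for f n
    unfolding mult.commute[of A f] fps_mult_nth atLeast0AtMost by (simp add: A_def mult.commute)
  have noise: "(\<lambda>n. of_real (r ^ n) *\<^sub>C (\<Sum>j\<le>n. \<alpha> (n - j) * \<epsilon> j) *\<^sub>C \<phi> n) =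
      (\<lambda>n. of_real (r ^ n) *\<^sub>C fps_nth (A * E) n *\<^sub>C \<phi> n)" for r
    by (simp add: nth E_def)
  have signal: "(\<lambda>n. of_real (r ^ n) *\<^sub>C (\<Sum>j\<le>n. \<alpha> (n - j) * (cinner x (\<phi> j) + \<epsilon> j)) *\<^sub>C \<phi> n) =
      (\<lambda>n. of_real (r ^ n) *\<^sub>C fps_nth (A * (X x + E)) n *\<^sub>C \<phi> n)" for r
    by (simp add: nth E_def X_def)
  have lim: "((\<lambda>r. synth \<phi> r (A * E)) \<longlongrightarrow> 0) (at_left 1)"
  proof (rule tendsto_synth_A_mult_zero[OF E])
    have "power_series \<epsilon> = eval_fps E"
      by (simp add: fun_eq_iff power_series_def eval_fps_def E_def)
    then show "((\<lambda>r. L2_norm \<mu> (\<lambda>t. eval_fps E (of_real r * circ t) - \<epsilon>_star t)) \<longlongrightarrow> 0) (at_left 1)"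
      using assms(7) by (simp add: has_L2_boundary_def circ_def)
    show "L2_fun \<mu> \<epsilon>_star"
      using assms(7) by (simp add: has_L2_boundary_def)
  qed
  have "((\<lambda>r. synth \<phi> r (A * X x) + synth \<phi> r (A * E)) \<longlongrightarrow> x + 0) (at_left 1)"
    by (intro tendsto_add tendsto_synth_X[OF assms(2)] lim)
  moreover have "\<forall>\<^sub>F r in at_left 1. synth \<phi> r (A * X x) + synth \<phi> r (A * E) = synth \<phi> r (A * (X x + E))"
    using eventually_at_left_1
  proof eventually_elim
    case (elim r)
    then show ?case
      by (simp add: distrib_left synth_add fps_conv_radius_A_mult fps_conv_radius_X E)
  qed
  ultimately have "((\<lambda>r. synth \<phi> r (A * (X x + E))) \<longlongrightarrow> x) (at_left 1)"
    by (simp add: tendsto_cong)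
  then show ?thesis
    unfolding noise signal synth_def[symmetric]
    using sums_synth[OF fps_conv_radius_A_mult[OF E]] sums_synth[OF fps_conv_radius_A_mult[OF XE]]
      tendsto_norm_zero[OF lim]
    by (auto simp: sums_iff)
qed

end
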